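(* Suppose that $\alpha$ is a continuous action of the torus $\mathbb{T}^k$ on a $C^*$-algebra $A$. For $a\in A$ and $j\in\mathbb{Z}^k$ let $a_j:=\int_{\mathbb{T}^k}z^{-j}\alpha_z(a)\,dz$ be the $j$th Fourier coefficient of $a$, and set \[ s_n(a):=\sum_{-n\le j\le n}a_j\quad\text{for } n\in\mathbb{N}^k,\qquad \sigma_N(a):=\frac{1}{\prod_{j=1}^k(N_j+1)}\sum_{0\le n\le N}s_n(a)\quad\text{for } N\in\mathbb{N}^k . \] Then for every $a\in A$, $\|\sigma_N(a)-a\|\to0$ as $N\to\infty$ in $\mathbb{N}^k$.
   Context: A continuous action of $\mathbb{T}^k$ on $A$ is a homomorphism $\alpha:\mathbb{T}^k\to\operatorname{Aut}A$ such that $z\mapsto\alpha_z(a)$ is norm-continuous for each $a\in A$. The integral is the norm-convergent $A$-valued integral with respect to normalised Haar measure on $\mathbb{T}^k$; $z^n:=\prod_iz_i^{n_i}$. Inequalities in $\mathbb{Z}^k$ are coordinatewise, $0\in\mathbb{N}$, and $N\to\infty$ in $\mathbb{N}^k$ means convergence along the directed set $\mathbb{N}^k$ (that is, $\min_jN_j\to\infty$). *)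

theory Defs
  imports "HOL-Analysis.Analysis"
begin

text \<open>
  C*-algebras, not assumed unital and possibly zero. Submultiplicativity of the norm and
  completeness come from the parent classes; the complex scalar multiplication extends the real
  one. Linearity of the complex scalar multiplication in each argument, together with
  \<open>scaleC_of_real\<close> at \<open>r = 1\<close>, gives the axioms of a complex vector space.
\<close>

class cstar_algebra = real_normed_algebra + banach +
  fixes scaleC :: "complex \<Rightarrow> 'a \<Rightarrow> 'a"  (infixr \<open>*\<^sub>C\<close> 75)
    and star :: "'a \<Rightarrow> 'a"
  assumes scaleC_add_right: "c *\<^sub>C (x + y) = c *\<^sub>C x + c *\<^sub>C y"
    and scaleC_add_left: "(c + d) *\<^sub>C x = c *\<^sub>C x + d *\<^sub>C x"
    and scaleC_scaleC: "c *\<^sub>C d *\<^sub>C x = (c * d) *\<^sub>C x"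
    and scaleC_of_real: "complex_of_real r *\<^sub>C x = r *\<^sub>R x"
    and norm_scaleC: "norm (c *\<^sub>C x) = cmod c * norm x"
    and mult_scaleC_left: "(c *\<^sub>C x) * y = c *\<^sub>C (x * y)"
    and mult_scaleC_right: "x * (c *\<^sub>C y) = c *\<^sub>C (x * y)"
    and star_star: "star (star x) = x"
    and star_add: "star (x + y) = star x + star y"
    and star_scaleC: "star (c *\<^sub>C x) = cnj c *\<^sub>C star x"
    and star_mult: "star (x * y) = star y * star x"
    and cstar_identity: "norm (star x * x) = (norm x)\<^sup>2"

definition star_automorphism :: "('a::cstar_algebra \<Rightarrow> 'a) \<Rightarrow> bool" where
  "star_automorphism \<phi> \<longleftrightarrow>
     bij \<phi> \<and>
     (\<forall>x y. \<phi> (x + y) = \<phi> x + \<phi> y) \<and>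
     (\<forall>c x. \<phi> (c *\<^sub>C x) = c *\<^sub>C \<phi> x) \<and>
     (\<forall>x y. \<phi> (x * y) = \<phi> x * \<phi> y) \<and>
     (\<forall>x. \<phi> (star x) = star (\<phi> x))"

text \<open>The torus is a group under the componentwise product of \<^typ>\<open>complex ^ 'k\<close>.\<close>

definition torus :: "(complex ^ 'k) set" where
  "torus = {z. \<forall>i. cmod (z $ i) = 1}"

text \<open>Values of \<open>\<alpha>\<close> outside \<^const>\<open>torus\<close> are irrelevant.\<close>

definition continuous_torus_action :: "(complex ^ 'k \<Rightarrow> 'a::cstar_algebra \<Rightarrow> 'a) \<Rightarrow> bool" where
  "continuous_torus_action \<alpha> \<longleftrightarrow>
     (\<forall>z\<in>torus. star_automorphism (\<alpha> z)) \<and>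
     (\<forall>z\<in>torus. \<forall>w\<in>torus. \<alpha> (z * w) = \<alpha> z \<circ> \<alpha> w) \<and>
     (\<forall>a. continuous_on torus (\<lambda>z. \<alpha> z a))"

text \<open>
  Integration against normalised Haar measure on the torus, which is the image of Lebesgue measure
  on the unit cube under \<open>t \<mapsto> (exp (2\<pi>i t\<^sub>1), \<dots>, exp (2\<pi>i t\<^sub>k))\<close>. The gauge
  integral is used because the library's Bochner integral requires a second countable (that is,
  separable) codomain; on continuous functions it is the norm limit of Riemann sums.
\<close>

definition torus_integral :: "(complex ^ 'k \<Rightarrow> 'a::banach) \<Rightarrow> 'a" where
  "torus_integral f = integral (cbox (0 :: real ^ 'k) 1) (\<lambda>t. f (\<chi> i. cis (2 * pi * t $ i)))"

lemma torus_integrable_continuous: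
  fixes f :: "complex ^ 'k \<Rightarrow> 'a::banach"
  assumes "continuous_on torus f"
  shows "(\<lambda>t. f (\<chi> i. cis (2 * pi * t $ i))) integrable_on cbox (0 :: real ^ 'k) 1"
proof (rule integrable_continuous)
  show "continuous_on (cbox 0 1) (\<lambda>t :: real ^ 'k. f (\<chi> i. cis (2 * pi * t $ i)))"
    by (rule continuous_on_compose2[OF assms]) (auto simp: torus_def intro!: continuous_intros)
qed

lemma torus_integral_const: "torus_integral (\<lambda>_ :: complex ^ 'k. c) = c"
  by (simp add: torus_integral_def content_cbox_cart interval_ne_empty_cart)

definition torus_monomial :: "complex ^ 'k \<Rightarrow> int ^ 'k \<Rightarrow> complex" where
  "torus_monomial z n = (\<Prod>i\<in>UNIV. z $ i powi n $ i)"

definition fourier_coeff ::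
    "(complex ^ 'k \<Rightarrow> 'a::cstar_algebra \<Rightarrow> 'a) \<Rightarrow> 'a \<Rightarrow> int ^ 'k \<Rightarrow> 'a" where
  "fourier_coeff \<alpha> a j = torus_integral (\<lambda>z. torus_monomial z (- j) *\<^sub>C \<alpha> z a)"

text \<open>The order on vectors is the coordinatewise one.\<close>

definition fourier_sum ::
    "(complex ^ 'k \<Rightarrow> 'a::cstar_algebra \<Rightarrow> 'a) \<Rightarrow> 'a \<Rightarrow> nat ^ 'k \<Rightarrow> 'a" where
  "fourier_sum \<alpha> a n =
     (\<Sum>j\<in>{- (\<chi> i. int (n $ i)) .. (\<chi> i. int (n $ i))}. fourier_coeff \<alpha> a j)"

definition cesaro_mean ::
    "(complex ^ 'k \<Rightarrow> 'a::cstar_algebra \<Rightarrow> 'a) \<Rightarrow> 'a \<Rightarrow> nat ^ 'k \<Rightarrow> 'a" where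
  "cesaro_mean \<alpha> a N =
     (1 / (\<Prod>i\<in>UNIV. real (N $ i) + 1)) *\<^sub>R (\<Sum>n\<in>{0..N}. fourier_sum \<alpha> a n)"

text \<open>
  The index ranges are finite, so the sums above are genuine, and \<^const>\<open>at_top\<close> on
  \<^typ>\<open>nat ^ 'k\<close> is the filter of the directed set of multi-indices.
\<close>

lemma finite_atLeastAtMost_vec:
  fixes a b :: "'b::order ^ 'k"
  assumes "\<And>i. finite {a $ i .. b $ i}"
  shows "finite {a..b}"
proof -
  have "{a..b} \<subseteq> vec_lambda ` (\<Pi>\<^sub>E i\<in>UNIV. {a $ i .. b $ i})"
  proof
    fix x assume "x \<in> {a..b}"
    then show "x \<in> vec_lambda ` (\<Pi>\<^sub>E i\<in>UNIV. {a $ i .. b $ i})"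
      by (intro image_eqI[of _ _ "vec_nth x"]) (auto simp: less_eq_vec_def)
  qed
  moreover have "finite (\<Pi>\<^sub>E i\<in>UNIV. {a $ i .. b $ i})"
    using assms by (intro finite_PiE) auto
  ultimately show ?thesis
    using finite_surj by blast
qed

lemma eventually_at_top_nat_vec:
  "eventually P (at_top :: (nat ^ 'k) filter) \<longleftrightarrow> (\<exists>M. \<forall>N\<ge>M. P N)"
proof -
  have "\<exists>L. {L..} \<subseteq> {M..} \<inter> {N..}" for M N :: "nat ^ 'k"
    by (rule exI[of _ "\<chi> i. max (M $ i) (N $ i)"]) (auto simp: less_eq_vec_def)
  then show ?thesis
    unfolding at_top_def
    by (subst eventually_INF_base) (auto simp: eventually_principal)
qed

end

theory Submission
  imports Defs
begin

text \<open>
  The mean \<open>\<sigma>\<^sub>N(a)\<close> is the integral of \<open>K\<^sub>N(z) \<alpha>\<^sub>z(a)\<close>, where \<open>K\<^sub>N\<close> is the product of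
  one-variable Fejer kernels, hence nonnegative. As in Korovkin's theorem no concentration
  estimate for \<open>K\<^sub>N\<close> is needed: by compactness of the torus,
  \<open>\<parallel>\<alpha>\<^sub>z(a) - a\<parallel> \<le> \<epsilon> + C \<Sum>\<^sub>i (1 - Re z\<^sub>i)\<close>, and integrating this against \<open>K\<^sub>N\<close> only requires
  \<open>\<integral>K\<^sub>N = 1\<close> and \<open>\<integral>K\<^sub>N Re z\<^sub>i = N\<^sub>i / (N\<^sub>i + 1)\<close>, which gives
  \<open>\<parallel>\<sigma>\<^sub>N(a) - a\<parallel> \<le> \<epsilon> + C \<Sum>\<^sub>i 1 / (N\<^sub>i + 1)\<close>.
\<close>

section \<open>Complex scalars and product integrals over the unit cube\<close>

lemma bounded_bilinear_scaleC:
  "bounded_bilinear (scaleC :: complex \<Rightarrow> 'a \<Rightarrow> 'a::cstar_algebra)"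
proof
  fix r :: real and c :: complex and x :: 'a
  show "(r *\<^sub>R c) *\<^sub>C x = r *\<^sub>R (c *\<^sub>C x)"
    by (simp add: scaleR_conv_of_real flip: scaleC_scaleC scaleC_of_real)
  show "c *\<^sub>C (r *\<^sub>R x) = r *\<^sub>R (c *\<^sub>C x)"
    by (simp add: scaleC_scaleC mult.commute flip: scaleC_of_real)
  show "\<exists>K. \<forall>(a::complex) b::'a. norm (a *\<^sub>C b) \<le> norm a * norm b * K"
    by (rule exI[of _ 1]) (simp add: norm_scaleC)
qed (auto simp: scaleC_add_left scaleC_add_right)

lemmas continuous_on_scaleC [continuous_intros] =
  bounded_bilinear.continuous_on[OF bounded_bilinear_scaleC]

text \<open>Fubini for a product of one-variable functions. Cutting each factor off by the indicator
  of \<open>{0..1}\<close> gives Lebesgue integrable functions on the line, to which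
  \<open>product_integral_prod\<close> applies. Gauge and Lebesgue integrals are identified only at
  the two ends, where continuity on a compact set supplies integrability.\<close>

lemma has_integral_unit_cube_prod:
  fixes f :: "'k::finite \<Rightarrow> real \<Rightarrow> real"
  assumes cont: "\<And>i. continuous_on {0..1} (f i)"
    and int: "\<And>i. (f i has_integral c i) {0..1}"
  shows "((\<lambda>t :: real ^ 'k. \<Prod>i\<in>UNIV. f i (t $ i)) has_integral (\<Prod>i\<in>UNIV. c i)) (cbox 0 1)"
proof -
  let ?g = "\<lambda>i s. indicator {0..1} s * f i s"
  interpret product_sigma_finite "\<lambda>_. lborel :: real measure" by standard
  have int_g: "integrable lborel (?g i)" for i
    using borel_integrable_compact[OF compact_Icc cont, of i] by simp
  have [measurable]: "?g i \<in> borel_measurable borel" for i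
    using borel_measurable_integrable[OF int_g] by simp
  have axis_inj: "inj (\<lambda>i::'k. axis i (1::real))"
    by (simp add: inj_on_def axis_eq_axis)
  have Basis_eq: "(Basis :: (real ^ 'k) set) = range (\<lambda>i. axis i 1)"
    by (auto simp: Basis_vec_def)
  \<comment> \<open>\<open>lborel\<close> on \<open>real ^ 'k\<close> is a product measure indexed
    by \<open>Basis\<close>, whereas the factors are indexed by coordinates; \<open>idx\<close>
    recovers the coordinate of a unit vector.\<close>
  define idx where "idx = inv (\<lambda>i::'k. axis i (1::real))"
  have idx [simp]: "idx (axis i 1) = i" for i
    unfolding idx_def by (rule inv_f_f[OF axis_inj])
  have prod_Basis: "(\<Prod>i\<in>UNIV. h i (axis i 1)) = (\<Prod>b\<in>Basis. h (idx b) b)"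
    for h :: "'k \<Rightarrow> real ^ 'k \<Rightarrow> real"
    unfolding Basis_eq by (subst prod.reindex[OF axis_inj]) simp
  have "integral\<^sup>L lborel (\<lambda>t :: real ^ 'k. \<Prod>i\<in>UNIV. ?g i (t $ i))
      = (\<integral>x. (\<Prod>i\<in>UNIV. ?g i ((\<Sum>b\<in>Basis. x b *\<^sub>R b) $ i)) \<partial>(\<Pi>\<^sub>M b\<in>(Basis::(real^'k) set). lborel))"
    by (subst lborel_eq, subst integral_distr) measurable
  also have "\<dots> = (\<integral>x. (\<Prod>b\<in>Basis. ?g (idx b) (x b)) \<partial>(\<Pi>\<^sub>M b\<in>(Basis::(real^'k) set). lborel))"
  proof (rule Bochner_Integration.integral_cong[OF refl])
    fix x :: "real ^ 'k \<Rightarrow> real"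
    have "(\<Sum>b\<in>Basis. x b *\<^sub>R b) $ i = x (axis i 1)" for i
      by (simp add: cart_eq_inner_axis)
    then show "(\<Prod>i\<in>UNIV. ?g i ((\<Sum>b\<in>Basis. x b *\<^sub>R b) $ i)) = (\<Prod>b\<in>Basis. ?g (idx b) (x b))"
      using prod_Basis[of "\<lambda>i b. ?g i (x b)"] by simp
  qed
  also have "\<dots> = (\<Prod>b\<in>(Basis::(real^'k) set). integral\<^sup>L lborel (?g (idx b)))"
    by (rule product_integral_prod) (auto intro: int_g)
  also have "\<dots> = (\<Prod>i\<in>UNIV. integral\<^sup>L lborel (?g i))"
    using prod_Basis[of "\<lambda>i b. integral\<^sup>L lborel (?g i)"] by simp
  also have "\<dots> = (\<Prod>i\<in>UNIV. c i)"
  proof (rule prod.cong[OF refl])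
    fix i
    have "set_integrable lborel {0..1} (f i)"
      using int_g[of i] by (simp add: set_integrable_def)
    from set_borel_integral_eq_integral(2)[OF this] show "integral\<^sup>L lborel (?g i) = c i"
      using int[of i] by (simp add: set_lebesgue_integral_def integral_unique)
  qed
  finally have eq: "integral\<^sup>L lborel (\<lambda>t :: real ^ 'k. \<Prod>i\<in>UNIV. ?g i (t $ i)) = (\<Prod>i\<in>UNIV. c i)" .
  \<comment> \<open>The cutoffs multiply to the indicator of the cube: outside it some coordinate
    leaves \<open>{0..1}\<close> and its factor vanishes.\<close>
  have ind: "(\<Prod>i\<in>UNIV. ?g i (t $ i)) = indicator (cbox 0 1) t * (\<Prod>i\<in>UNIV. f i (t $ i))"
    for t :: "real ^ 'k"
  proof (cases "t \<in> cbox 0 1")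
    case True
    then show ?thesis by (simp add: mem_box_cart)
  next
    case False
    then obtain i where "t $ i \<notin> {0..1}" by (auto simp: mem_box_cart)
    then have "\<exists>i\<in>UNIV. ?g i (t $ i) = 0" by (intro bexI[of _ i]) auto
    then show ?thesis using False by (simp add: prod_zero)
  qed
  have cont': "continuous_on (cbox 0 1) (\<lambda>t :: real ^ 'k. \<Prod>i\<in>UNIV. f i (t $ i))"
    by (intro continuous_on_prod continuous_on_compose2[OF cont] continuous_intros)
       (auto simp: mem_box_cart)
  have "set_integrable lborel (cbox 0 1) (\<lambda>t :: real ^ 'k. \<Prod>i\<in>UNIV. f i (t $ i))"
    using borel_integrable_compact[OF compact_cbox cont'] by (simp add: set_integrable_def)
  from set_borel_integral_eq_integral[OF this] show ?thesis
    using eq unfolding ind by (simp add: set_lebesgue_integral_def has_integral_iff)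
qed

section \<open>The Fejer kernel in one variable\<close>

lemma has_integral_cis_int:
  fixes l :: int
  shows "((\<lambda>t. cis (2 * pi * t) powi l) has_integral (if l = 0 then 1 else 0)) {0..1}"
proof (cases "l = 0")
  case True
  then show ?thesis using has_integral_const_real[of "1::complex" 0 1] by simp
next
  case False
  \<comment> \<open>With this \<open>A\<close> the integrand is \<open>exp (t *\<^sub>R A)\<close>,
    with antiderivative \<open>exp (t *\<^sub>R A) / A\<close>, whose values at 0 and 1 agree
    because \<open>exp A = 1\<close>.\<close>
  define A where "A = \<i> * of_int l * (2 * pi)"
  have "A \<noteq> 0" using False by (simp add: A_def)
  have cis_eq: "cis (2 * pi * t) powi l = exp (t *\<^sub>R A)" for t
    by (subst cis_power_int) (simp add: A_def cis_conv_exp scaleR_conv_of_real mult_ac)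
  have "((\<lambda>t. exp (t *\<^sub>R A) / A) has_vector_derivative exp (x *\<^sub>R A) * A / A) (at x within {0..1})" for x
    by (intro has_vector_derivative_divide exp_scaleR_has_vector_derivative_right)
  then have "((\<lambda>t. exp (t *\<^sub>R A)) has_integral exp (1 *\<^sub>R A) / A - exp (0 *\<^sub>R A) / A) {0..1}"
    using \<open>A \<noteq> 0\<close> by (intro fundamental_theorem_of_calculus) auto
  moreover have "exp (1 *\<^sub>R A) = 1"
    unfolding cis_eq[symmetric] by simp
  ultimately show ?thesis using False by (simp add: cis_eq)
qed

text \<open>The squared modulus makes nonnegativity immediate. On the unit circle this is the
  classical Fejer kernel, the average of the Dirichlet kernels of orders 0 to \<open>n\<close>; see
  \<open>fejer_expansion\<close>.\<close>

definition fejer :: "nat \<Rightarrow> complex \<Rightarrow> real" where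
  "fejer n z = (cmod (\<Sum>p\<le>n. z ^ p))\<^sup>2 / (real n + 1)"

lemma fejer_nonneg: "fejer n z \<ge> 0"
  by (simp add: fejer_def)

lemma dirichlet_sum_Suc:
  fixes z :: complex
  shows "(\<Sum>l\<in>{- int (Suc m)..int (Suc m)}. z powi - l)
    = (\<Sum>l\<in>{- int m..int m}. z powi - l) + z ^ Suc m + inverse z ^ Suc m"
proof -
  have "{- int (Suc m)..int (Suc m)} = insert (- int (Suc m)) (insert (int (Suc m)) {- int m..int m})"
    by auto
  then show ?thesis
    by (simp add: power_int_minus power_int_inverse add_ac del: of_nat_Suc power_Suc flip: power_int_of_nat)
qed

text \<open>The right-hand side is what the double sum of \<open>z ^ p * inverse z ^ q\<close> over
  \<open>p, q \<le> n\<close> gains when \<open>n\<close> grows by one: a row with exponents 1 to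
  \<open>n + 1\<close>, a column with their negatives, and the corner 1. Together these are the
  exponents of the Dirichlet sum of order \<open>n + 1\<close>.\<close>

lemma dirichlet_sum_eq:
  fixes z :: complex
  assumes "z \<noteq> 0"
  shows "(\<Sum>l\<in>{- int (Suc n)..int (Suc n)}. z powi - l)
    = z ^ Suc n * (\<Sum>q\<le>n. inverse z ^ q) + inverse z ^ Suc n * (\<Sum>p\<le>n. z ^ p) + 1"
proof (induction n)
  case 0
  then show ?case by (subst dirichlet_sum_Suc) simp
next
  case (Suc n)
  \<comment> \<open>Splitting off the exponent 0 isolates the two new outermost powers; the
    remaining factor \<open>w\<close> cancels one power and leaves the induction hypothesis.\<close>
  have shift: "(\<Sum>q\<le>Suc n. w ^ q) = 1 + w * (\<Sum>q\<le>n. w ^ q)" for w :: complex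
    by (subst sum.atMost_Suc_shift) (simp add: sum_distrib_left)
  have "z ^ Suc (Suc n) * inverse z = z ^ Suc n" "inverse z ^ Suc (Suc n) * z = inverse z ^ Suc n"
    using assms by auto
  then have "z ^ Suc (Suc n) * (inverse z * x) = z ^ Suc n * x"
    "inverse z ^ Suc (Suc n) * (z * x) = inverse z ^ Suc n * x" for x
    by (metis mult.assoc)+
  then show ?case
    by (subst dirichlet_sum_Suc, subst Suc.IH)
       (simp only: shift distrib_left, simp)
qed

text \<open>On the unit circle \<open>cnj z = inverse z\<close>, so the squared modulus is a product
  of two geometric sums. By \<open>dirichlet_sum_eq\<close> each increase of \<open>n\<close> adds
  one Dirichlet sum to this product. The sign in \<open>- l\<close> matches that in
  \<open>fourier_coeff\<close>.\<close>

lemma fejer_expansion: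
  assumes "cmod z = 1"
  shows "complex_of_real (fejer n z)
    = (\<Sum>m=0..n. \<Sum>l\<in>{- int m..int m}. z powi - l) / (of_nat n + 1)"
proof -
  have z: "z \<noteq> 0" "cnj z = inverse z"
    using assms by (auto simp: inverse_complex_def complex_eq_iff cmod_def)
  have prod: "(\<Sum>p\<le>n. z ^ p) * (\<Sum>q\<le>n. inverse z ^ q)
      = (\<Sum>m=0..n. \<Sum>l\<in>{- int m..int m}. z powi - l)"
  proof (induction n)
    case (Suc n)
    have "z ^ Suc n * inverse z ^ Suc n = 1"
      using z by (simp del: power_Suc flip: power_mult_distrib)
    then have "(\<Sum>p\<le>Suc n. z ^ p) * (\<Sum>q\<le>Suc n. inverse z ^ q)
      = (\<Sum>p\<le>n. z ^ p) * (\<Sum>q\<le>n. inverse z ^ q)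
        + (z ^ Suc n * (\<Sum>q\<le>n. inverse z ^ q) + inverse z ^ Suc n * (\<Sum>p\<le>n. z ^ p) + 1)"
      by (simp only: sum.atMost_Suc distrib_left distrib_right) (simp only: mult_ac add_ac)
    then show ?case
      by (simp only: Suc.IH flip: dirichlet_sum_eq[OF z(1)]) simp
  qed simp
  have "complex_of_real ((cmod (\<Sum>p\<le>n. z ^ p))\<^sup>2) = (\<Sum>p\<le>n. z ^ p) * (\<Sum>q\<le>n. inverse z ^ q)"
    by (simp only: complex_norm_square cnj_sum complex_cnj_power z(2))
  then show ?thesis
    unfolding fejer_def of_real_divide prod by simp
qed

lemma continuous_on_fejer_cis [continuous_intros]:
  "continuous_on S g \<Longrightarrow> continuous_on S (\<lambda>t. fejer n (cis (g t)))"
  unfolding fejer_def by (intro continuous_intros) auto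

text \<open>By orthogonality only the terms with \<open>l = k\<close> survive, one for each
  \<open>m\<close> in \<open>{k..n}\<close>. Truncated subtraction gives the correct value 0 when
  \<open>k > n\<close>. The cases \<open>k = 0\<close> and \<open>k = 1\<close> supply the total
  mass and the first moment.\<close>

lemma has_integral_fejer_mult_power:
  fixes k :: nat
  shows "((\<lambda>t. fejer n (cis (2 * pi * t)) * Re (cis (2 * pi * t) ^ k))
    has_integral real (Suc n - k) / (real n + 1)) {0..1}"
proof -
  let ?z = "\<lambda>t. cis (2 * pi * t)"
  have "((\<lambda>t. (\<Sum>m=0..n. \<Sum>l\<in>{- int m..int m}. ?z t powi (int k - l)) / (of_nat n + 1))
    has_integral (\<Sum>m=0..n. \<Sum>l\<in>{- int m..int m}. if int k - l = 0 then 1 else 0) / (of_nat n + 1)) {0..1}"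
    by (intro has_integral_divide has_integral_sum has_integral_cis_int) auto
  moreover have "(\<Sum>m=0..n. \<Sum>l\<in>{- int m..int m}. if int k - l = 0 then 1 else 0)
      = (of_nat (Suc n - k) :: complex)"
  proof -
    have "(\<Sum>m=0..n. \<Sum>l\<in>{- int m..int m}. if int k - l = 0 then 1 else (0::complex))
        = (\<Sum>m=0..n. if k \<le> m then 1 else 0)"
      by (intro sum.cong refl) (auto simp: if_distrib cong: if_cong)
    also have "\<dots> = of_nat (card {m\<in>{0..n}. k \<le> m})"
      by (simp add: sum.If_cases Int_def)
    also have "{m\<in>{0..n}. k \<le> m} = {k..n}" by auto
    finally show ?thesis by simp
  qed
  moreover have "(\<Sum>m=0..n. \<Sum>l\<in>{- int m..int m}. ?z t powi (int k - l)) / (of_nat n + 1)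
      = complex_of_real (fejer n (?z t)) * ?z t ^ k" for t
    by (simp add: fejer_expansion power_int_diff power_int_minus divide_inverse sum_distrib_right sum_distrib_left mult_ac)
  ultimately have "((\<lambda>t. complex_of_real (fejer n (?z t)) * ?z t ^ k)
    has_integral of_nat (Suc n - k) / (of_nat n + 1)) {0..1}"
    by simp
  \<comment> \<open>The kernel is real, so taking real parts affects only the power.\<close>
  from has_integral_linear[OF this bounded_linear_Re]
  show ?thesis by (simp add: o_def Re_divide_of_nat flip: of_nat_Suc)
qed

section \<open>The product kernel and the Cesaro means\<close>

lemma sum_atLeastAtMost_vec_prod:
  fixes a b :: "'b::order ^ 'k" and f :: "'k \<Rightarrow> 'b \<Rightarrow> 'c::comm_semiring_1"
  assumes "\<And>i. finite {a $ i .. b $ i}"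
  shows "(\<Sum>x\<in>{a..b}. \<Prod>i\<in>UNIV. f i (x $ i)) = (\<Prod>i\<in>UNIV. \<Sum>y\<in>{a $ i .. b $ i}. f i y)"
proof -
  have "(\<Prod>i\<in>UNIV. \<Sum>y\<in>{a $ i .. b $ i}. f i y)
      = (\<Sum>g\<in>(\<Pi>\<^sub>E i\<in>UNIV. {a $ i .. b $ i}). \<Prod>i\<in>UNIV. f i (g i))"
    using assms by (intro prod_sum_PiE) auto
  also have "\<dots> = (\<Sum>x\<in>{a..b}. \<Prod>i\<in>UNIV. f i (x $ i))"
    by (rule sum.reindex_bij_witness[of _ vec_nth vec_lambda]) (auto simp: less_eq_vec_def PiE_def)
  finally show ?thesis by simp
qed

definition torus_exp :: "real ^ 'k \<Rightarrow> complex ^ 'k" where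
  "torus_exp t = (\<chi> i. cis (2 * pi * t $ i))"

lemma torus_exp_nth [simp]: "torus_exp t $ i = cis (2 * pi * t $ i)"
  by (simp add: torus_exp_def)

lemma torus_exp_in_torus [simp]: "torus_exp t \<in> torus"
  by (simp add: torus_def)

lemma torus_integral_eq: "torus_integral f = integral (cbox 0 1) (\<lambda>t. f (torus_exp t))"
  by (simp add: torus_integral_def torus_exp_def)

definition fejer_prod :: "nat ^ 'k \<Rightarrow> complex ^ 'k \<Rightarrow> real" where
  "fejer_prod N z = (\<Prod>i\<in>UNIV. fejer (N $ i) (z $ i))"

lemma fejer_prod_nonneg: "fejer_prod N z \<ge> 0"
  unfolding fejer_prod_def by (intro prod_nonneg ballI fejer_nonneg)

lemma continuous_on_fejer_prod: "continuous_on S (fejer_prod N)"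
  unfolding fejer_prod_def fejer_def by (intro continuous_intros) auto

text \<open>Both index ranges are boxes, so the distributive law
  \<open>sum_atLeastAtMost_vec_prod\<close> applies twice to the product of one-variable expansions:
  first to the orders \<open>n\<close>, then to the frequencies \<open>j\<close>.\<close>

lemma fejer_prod_expansion:
  fixes N :: "nat ^ 'k"
  assumes "z \<in> torus"
  shows "complex_of_real (fejer_prod N z) = (1 / (\<Prod>i\<in>UNIV. real (N $ i) + 1)) *\<^sub>R
    (\<Sum>n\<in>{0..N}. \<Sum>j\<in>{- (\<chi> i. int (n $ i)) .. (\<chi> i. int (n $ i))}. torus_monomial z (- j))"
proof -
  have "complex_of_real (fejer_prod N z)
      = (\<Prod>i\<in>UNIV. (\<Sum>m=0..N $ i. \<Sum>l\<in>{- int m..int m}. z $ i powi - l) / (of_nat (N $ i) + 1))"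
    unfolding fejer_prod_def of_real_prod
    using assms by (intro prod.cong refl fejer_expansion) (auto simp: torus_def)
  also have "\<dots> = (\<Prod>i\<in>UNIV. \<Sum>m=0..N $ i. \<Sum>l\<in>{- int m..int m}. z $ i powi - l)
      / (\<Prod>i\<in>UNIV. of_nat (N $ i) + 1)"
    by (rule prod_dividef)
  also have "(\<Prod>i\<in>UNIV. \<Sum>m=0..N $ i. \<Sum>l\<in>{- int m..int m}. z $ i powi - l)
      = (\<Sum>n\<in>{0..N}. \<Prod>i\<in>UNIV. \<Sum>l\<in>{- int (n $ i)..int (n $ i)}. z $ i powi - l)"
    by (subst sum_atLeastAtMost_vec_prod[where f = "\<lambda>i m. \<Sum>l\<in>{- int m..int m}. z $ i powi - l"]) auto
  also have "\<dots> = (\<Sum>n\<in>{0..N}. \<Sum>j\<in>{- (\<chi> i. int (n $ i)) .. (\<chi> i. int (n $ i))}. torus_monomial z (- j))"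
    unfolding torus_monomial_def
    by (intro sum.cong refl)
       (use sum_atLeastAtMost_vec_prod[where f = "\<lambda>i l. z $ i powi - l"] in simp)
  finally show ?thesis
    by (simp add: scaleR_conv_of_real divide_inverse mult.commute)
qed

text \<open>The finite sums move inside the integral, where \<open>fejer_prod_expansion\<close>
  collects the monomials into the kernel; since the kernel is real, \<open>scaleC_of_real\<close>
  turns complex scaling by it into real scaling.\<close>

lemma cesaro_mean_eq_integral:
  fixes N :: "nat ^ 'k" and \<alpha> :: "complex ^ 'k \<Rightarrow> 'a::cstar_algebra \<Rightarrow> 'a"
  assumes cont: "continuous_on torus (\<lambda>z. \<alpha> z a)"
  shows "cesaro_mean \<alpha> a N = integral (cbox 0 1) (\<lambda>t. fejer_prod N (torus_exp t) *\<^sub>R \<alpha> (torus_exp t) a)"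
proof -
  let ?J = "\<lambda>n :: nat ^ 'k. {- (\<chi> i. int (n $ i)) .. (\<chi> i. int (n $ i))}"
  let ?h = "\<lambda>j t. torus_monomial (torus_exp t) (- j) *\<^sub>C \<alpha> (torus_exp t) a"
  have fin: "finite (?J n)" "finite {0..n}" for n
    by (auto intro: finite_atLeastAtMost_vec)
  \<comment> \<open>Exponents may be negative, so continuity relies on coordinates being nonzero on
    the torus.\<close>
  have "continuous_on torus (\<lambda>z :: complex ^ 'k. torus_monomial z j)" for j
    unfolding torus_monomial_def
    by (intro continuous_intros) (metis (mono_tags, lifting) mem_Collect_eq norm_zero torus_def zero_neq_one)
  then have "continuous_on torus (\<lambda>z. torus_monomial z (- j) *\<^sub>C \<alpha> z a)" for j
    by (intro continuous_intros cont)
  from torus_integrable_continuous[OF this]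
  have int: "?h j integrable_on cbox 0 1" for j
    by (simp add: torus_exp_def)
  interpret L: bounded_linear "\<lambda>c. c *\<^sub>C x" for x :: 'a
    by (rule bounded_bilinear.bounded_linear_left[OF bounded_bilinear_scaleC])
  have "cesaro_mean \<alpha> a N = (1 / (\<Prod>i\<in>UNIV. real (N $ i) + 1)) *\<^sub>R
      (\<Sum>n\<in>{0..N}. \<Sum>j\<in>?J n. integral (cbox 0 1) (?h j))"
    by (simp add: cesaro_mean_def fourier_sum_def fourier_coeff_def torus_integral_eq)
  also have "\<dots> = integral (cbox 0 1) (\<lambda>t. (1 / (\<Prod>i\<in>UNIV. real (N $ i) + 1)) *\<^sub>R
      (\<Sum>n\<in>{0..N}. \<Sum>j\<in>?J n. ?h j t))"
    by (simp only: integral_cmul integral_sum fin int integrable_sum)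
  also have "\<dots> = integral (cbox 0 1) (\<lambda>t. fejer_prod N (torus_exp t) *\<^sub>R \<alpha> (torus_exp t) a)"
    by (rule arg_cong[where f = "integral _"])
       (simp add: fun_eq_iff fejer_prod_expansion L.sum L.scaleR flip: scaleC_of_real)
  finally show ?thesis .
qed

section \<open>Moments of the product kernel\<close>

lemma has_integral_fejer_prod:
  "((\<lambda>t :: real ^ 'k. fejer_prod N (torus_exp t)) has_integral 1) (cbox 0 1)"
proof -
  have "((\<lambda>t. fejer n (cis (2 * pi * t))) has_integral 1) {0..1}" for n
    using has_integral_fejer_mult_power[of n 0] by (simp add: add.commute)
  then show ?thesis
    using has_integral_unit_cube_prod[of "\<lambda>i t. fejer (N $ i) (cis (2 * pi * t))" "\<lambda>_. 1"]
    by (simp add: fejer_prod_def continuous_intros)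
qed

lemma has_integral_fejer_prod_mult_Re:
  "((\<lambda>t :: real ^ 'k. fejer_prod N (torus_exp t) * Re (torus_exp t $ i))
    has_integral real (N $ i) / (real (N $ i) + 1)) (cbox 0 1)"
proof -
  \<comment> \<open>Exponent 1 in coordinate \<open>i\<close> and 0 elsewhere puts the integrand in
    product form; every factor other than the \<open>i\<close>th then integrates to 1.\<close>
  let ?k = "\<lambda>j. if j = i then 1 else 0 :: nat"
  have "((\<lambda>t :: real ^ 'k. \<Prod>j\<in>UNIV. fejer (N $ j) (cis (2 * pi * t $ j)) * Re (cis (2 * pi * t $ j) ^ ?k j))
      has_integral (\<Prod>j\<in>UNIV. real (Suc (N $ j) - ?k j) / (real (N $ j) + 1))) (cbox 0 1)"
    by (intro has_integral_unit_cube_prod has_integral_fejer_mult_power continuous_intros)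
  moreover have "(\<Prod>j\<in>UNIV. real (Suc (N $ j) - ?k j) / (real (N $ j) + 1))
      = (\<Prod>j\<in>UNIV. if j = i then real (N $ i) / (real (N $ i) + 1) else 1)"
    by (intro prod.cong) auto
  moreover have "(\<Prod>j\<in>UNIV. Re (z j ^ ?k j)) = Re (z i)" for z
  proof -
    have "(\<Prod>j\<in>UNIV. Re (z j ^ ?k j)) = (\<Prod>j\<in>UNIV. if j = i then Re (z i) else 1)"
      by (intro prod.cong) auto
    then show ?thesis by simp
  qed
  ultimately show ?thesis
    by (simp add: prod.distrib fejer_prod_def)
qed

section \<open>The Korovkin estimate\<close>

lemma compact_torus: "compact (torus :: (complex ^ 'k) set)"
proof -
  have "closed (torus :: (complex ^ 'k) set)"
    unfolding torus_def by (intro closed_Collect_all closed_Collect_eq continuous_intros)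
  moreover have "norm z \<le> real CARD('k)" if "z \<in> torus" for z :: "complex ^ 'k"
    using L2_set_le_sum[of UNIV "\<lambda>i. cmod (z $ i)"] that by (simp add: torus_def norm_vec_def)
  ultimately show ?thesis
    by (auto simp: compact_eq_bounded_closed bounded_iff)
qed

lemma one_in_torus [simp]: "1 \<in> torus"
  by (simp add: torus_def)

text \<open>A complex number \<open>w\<close> of modulus 1 satisfies
  \<open>(cmod (w - 1))\<^sup>2 = 2 * (1 - Re w)\<close>. Hence the sum of the test functions
  controls the distance to the identity of the torus.\<close>

lemma torus_dist_one_sq:
  fixes z :: "complex ^ 'k"
  assumes "z \<in> torus"
  shows "(dist z 1)\<^sup>2 = 2 * (\<Sum>i\<in>UNIV. 1 - Re (z $ i))"
proof -
  have "(cmod (z $ i - 1))\<^sup>2 = 2 * (1 - Re (z $ i))" for i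
  proof -
    have "(Re (z $ i))\<^sup>2 + (Im (z $ i))\<^sup>2 = 1"
      using assms by (simp add: torus_def flip: cmod_power2)
    then show ?thesis unfolding cmod_power2 by (simp add: power2_eq_square algebra_simps)
  qed
  moreover have "(dist z 1)\<^sup>2 = (\<Sum>i\<in>UNIV. (cmod (z $ i - 1))\<^sup>2)"
    by (simp add: dist_vec_def L2_set_def dist_norm sum_nonneg)
  ultimately show ?thesis
    by (simp add: sum_distrib_left)
qed

text \<open>Within \<delta> of 1 continuity gives the bound \<epsilon>. Elsewhere a global bound
  \<open>M\<close>, from compactness, is at most \<open>M\<close> times the squared ratio of
  \<open>dist z 1\<close> to \<delta>, which is a multiple of the test functions.\<close>

lemma torus_continuity_bound:
  fixes f :: "complex ^ 'k \<Rightarrow> 'a::real_normed_vector"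
  assumes cont: "continuous_on torus f" and "\<epsilon> > 0"
  obtains C where "\<And>z. z \<in> torus \<Longrightarrow> norm (f z - f 1) \<le> \<epsilon> + C * (\<Sum>i\<in>UNIV. 1 - Re (z $ i))"
proof -
  obtain \<delta> where \<delta>: "\<delta> > 0" "\<And>z. z \<in> torus \<Longrightarrow> dist z 1 < \<delta> \<Longrightarrow> dist (f z) (f 1) < \<epsilon>"
    using cont \<open>\<epsilon> > 0\<close> one_in_torus unfolding continuous_on_iff by meson
  have "compact ((\<lambda>z. f z - f 1) ` torus)"
    by (intro compact_continuous_image compact_torus continuous_intros cont)
  then obtain M where M: "M > 0" "\<And>z. z \<in> torus \<Longrightarrow> norm (f z - f 1) \<le> M"
    by (auto dest!: compact_imp_bounded simp: bounded_pos)
  show thesis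
  \<comment> \<open>The 2 absorbs the factor in \<open>torus_dist_one_sq\<close>.\<close>
  proof (rule that[of "2 * M / \<delta>\<^sup>2"])
    fix z :: "complex ^ 'k" assume z: "z \<in> torus"
    have eq: "2 * M / \<delta>\<^sup>2 * (\<Sum>i\<in>UNIV. 1 - Re (z $ i)) = M * ((dist z 1)\<^sup>2 / \<delta>\<^sup>2)"
      by (simp add: torus_dist_one_sq[OF z])
    show "norm (f z - f 1) \<le> \<epsilon> + 2 * M / \<delta>\<^sup>2 * (\<Sum>i\<in>UNIV. 1 - Re (z $ i))"
    proof (cases "dist z 1 < \<delta>")
      case True
      then have "norm (f z - f 1) \<le> \<epsilon>" using \<delta>(2)[OF z] by (simp add: dist_norm)
      moreover have "0 \<le> M * ((dist z 1)\<^sup>2 / \<delta>\<^sup>2)" using M by simp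
      ultimately show ?thesis unfolding eq by linarith
    next
      case False
      then have "1 \<le> (dist z 1)\<^sup>2 / \<delta>\<^sup>2"
        using \<delta>(1) by (simp add: power_mono)
      then have "M * 1 \<le> M * ((dist z 1)\<^sup>2 / \<delta>\<^sup>2)" using M by (intro mult_left_mono) auto
      then show ?thesis unfolding eq using M(2)[OF z] \<open>\<epsilon> > 0\<close> by linarith
    qed
  qed
qed

text \<open>Since the kernel has integral 1, \<open>f 1\<close> can be moved under the integral. The
  pointwise bound is then integrated against the kernel, with each \<open>1 - Re (z $ i)\<close>
  contributing \<open>1 / (N $ i + 1)\<close>.\<close>

lemma norm_fejer_prod_integral_diff_le:
  fixes f :: "complex ^ 'k \<Rightarrow> 'a::banach"
  assumes cont: "continuous_on torus f"
    and bound: "\<And>z. z \<in> torus \<Longrightarrow> norm (f z - f 1) \<le> \<epsilon> + C * (\<Sum>i\<in>UNIV. 1 - Re (z $ i))"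
  shows "norm (integral (cbox 0 1) (\<lambda>t. fejer_prod N (torus_exp t) *\<^sub>R f (torus_exp t)) - f 1)
    \<le> \<epsilon> + C * (\<Sum>i\<in>UNIV. 1 / (real (N $ i) + 1))"
proof -
  let ?K = "\<lambda>t. fejer_prod N (torus_exp t)"
  let ?b = "\<lambda>t. ?K t * (\<epsilon> + C * (\<Sum>i\<in>UNIV. 1 - Re (torus_exp t $ i)))"
  have "continuous_on torus (\<lambda>z. fejer_prod N z *\<^sub>R f z)"
    by (intro continuous_intros cont continuous_on_fejer_prod)
  then have int: "(\<lambda>t. ?K t *\<^sub>R f (torus_exp t)) integrable_on cbox 0 1"
    using torus_integrable_continuous by (force simp: torus_exp_def)
  have K1: "((\<lambda>t. ?K t *\<^sub>R f 1) has_integral f 1) (cbox 0 1)"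
    using has_integral_linear[OF has_integral_fejer_prod[of N] bounded_linear_scaleR_left[of "f 1"]]
    by (simp add: o_def)
  have diff: "((\<lambda>t. ?K t *\<^sub>R (f (torus_exp t) - f 1)) has_integral
      integral (cbox 0 1) (\<lambda>t. ?K t *\<^sub>R f (torus_exp t)) - f 1) (cbox 0 1)"
    using has_integral_diff[OF integrable_integral[OF int] K1] by (simp add: scaleR_diff_right)
  \<comment> \<open>The majorant is expanded so that only the two known moments occur.\<close>
  have "((\<lambda>t. ?K t * \<epsilon> + C * (\<Sum>i\<in>UNIV. ?K t - ?K t * Re (torus_exp t $ i))) has_integral
      1 * \<epsilon> + C * (\<Sum>i\<in>UNIV. 1 - real (N $ i) / (real (N $ i) + 1))) (cbox 0 1)"
    by (intro has_integral_add has_integral_mult_left has_integral_mult_right has_integral_sum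
        has_integral_diff has_integral_fejer_prod has_integral_fejer_prod_mult_Re finite)
  moreover have "?K t * \<epsilon> + C * (\<Sum>i\<in>UNIV. ?K t - ?K t * Re (torus_exp t $ i)) = ?b t" for t
  proof -
    have "(\<Sum>i\<in>UNIV. ?K t - ?K t * Re (torus_exp t $ i)) = ?K t * (\<Sum>i\<in>UNIV. 1 - Re (torus_exp t $ i))"
      by (simp add: sum_distrib_left right_diff_distrib)
    then show ?thesis by (simp add: distrib_left mult_ac)
  qed
  moreover have "1 - real n / (real n + 1) = 1 / (real n + 1)" for n
    by (simp add: field_simps)
  ultimately have b: "(?b has_integral \<epsilon> + C * (\<Sum>i\<in>UNIV. 1 / (real (N $ i) + 1))) (cbox 0 1)"
    by simp
  \<comment> \<open>Nonnegativity of the kernel enters here: the norm passes through it without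
    absolute values.\<close>
  have "norm (?K t *\<^sub>R (f (torus_exp t) - f 1)) \<le> ?b t" for t
    using bound[of "torus_exp t"] fejer_prod_nonneg[of N "torus_exp t"]
    by (simp add: mult_left_mono)
  then have "norm (integral (cbox 0 1) (\<lambda>t. ?K t *\<^sub>R (f (torus_exp t) - f 1))) \<le> integral (cbox 0 1) ?b"
    using diff b by (intro integral_norm_bound_integral) (auto simp: has_integral_iff)
  then show ?thesis
    using integral_unique[OF diff] integral_unique[OF b] by simp
qed

section \<open>Passage to the limit\<close>

lemma tendsto_sum_inverse_nat_vec:
  "((\<lambda>N :: nat ^ 'k. \<Sum>i\<in>UNIV. 1 / (real (N $ i) + 1)) \<longlongrightarrow> 0) at_top"
proof -
  have "((\<lambda>N :: nat ^ 'k. 1 / (real (N $ i) + 1)) \<longlongrightarrow> 0) at_top" for i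
  proof -
    have "filterlim (\<lambda>N :: nat ^ 'k. N $ i) at_top at_top"
      unfolding filterlim_at_top eventually_at_top_nat_vec
    proof
      fix m :: nat
      show "\<exists>M. \<forall>N\<ge>M. m \<le> N $ i"
        by (rule exI[of _ "\<chi> _. m"]) (auto simp: less_eq_vec_def)
    qed
    moreover have "((\<lambda>n. 1 / (real n + 1)) \<longlongrightarrow> 0) at_top"
      using LIMSEQ_inverse_real_of_nat by (simp add: inverse_eq_divide add.commute)
    ultimately show ?thesis by (rule filterlim_compose[rotated])
  qed
  from tendsto_sum[OF this] show ?thesis by simp
qed

text \<open>The map \<open>\<alpha> 1\<close> is its own square, and injectivity cancels one
  application. This identifies the value at the identity, around which the Korovkin bound is
  centred, with \<open>a\<close>.\<close>

lemma continuous_torus_action_one: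
  assumes "continuous_torus_action \<alpha>"
  shows "\<alpha> 1 a = a"
proof -
  have "bij (\<alpha> 1)" "\<alpha> (1 * 1) = \<alpha> 1 \<circ> \<alpha> 1"
    using assms one_in_torus unfolding continuous_torus_action_def star_automorphism_def by blast+
  then show ?thesis
    by (metis bij_is_inj comp_apply inj_eq mult_1)
qed

theorem propositionB1:
  fixes \<alpha> :: "complex ^ 'k \<Rightarrow> 'a::cstar_algebra \<Rightarrow> 'a"
  assumes "continuous_torus_action \<alpha>"
  shows "\<forall>a. ((\<lambda>N :: nat ^ 'k. norm (cesaro_mean \<alpha> a N - a)) \<longlongrightarrow> 0) at_top"
proof
  fix a
  have cont: "continuous_on torus (\<lambda>z. \<alpha> z a)"
    using assms by (simp add: continuous_torus_action_def)
  show "((\<lambda>N :: nat ^ 'k. norm (cesaro_mean \<alpha> a N - a)) \<longlongrightarrow> 0) at_top"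
  proof (rule tendstoI)
    fix \<epsilon> :: real assume "\<epsilon> > 0"
    \<comment> \<open>\<open>C\<close> depends on \<epsilon> but not on \<open>N\<close>; the other
      half of \<epsilon> absorbs the term that tends to 0.\<close>
    obtain C where C: "\<And>z. z \<in> torus \<Longrightarrow> norm (\<alpha> z a - \<alpha> 1 a) \<le> \<epsilon> / 2 + C * (\<Sum>i\<in>UNIV. 1 - Re (z $ i))"
      using torus_continuity_bound[OF cont, of "\<epsilon> / 2"] \<open>\<epsilon> > 0\<close> by auto
    have "((\<lambda>N :: nat ^ 'k. \<epsilon> / 2 + C * (\<Sum>i\<in>UNIV. 1 / (real (N $ i) + 1))) \<longlongrightarrow> \<epsilon> / 2 + C * 0) at_top"
      by (intro tendsto_intros tendsto_sum_inverse_nat_vec)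
    then have "\<forall>\<^sub>F N :: nat ^ 'k in at_top. \<epsilon> / 2 + C * (\<Sum>i\<in>UNIV. 1 / (real (N $ i) + 1)) < \<epsilon>"
      by (rule order_tendstoD(2)) (use \<open>\<epsilon> > 0\<close> in simp)
    then show "\<forall>\<^sub>F N :: nat ^ 'k in at_top. dist (norm (cesaro_mean \<alpha> a N - a)) 0 < \<epsilon>"
    proof eventually_elim
      case (elim N)
      have "norm (cesaro_mean \<alpha> a N - a) \<le> \<epsilon> / 2 + C * (\<Sum>i\<in>UNIV. 1 / (real (N $ i) + 1))"
        using norm_fejer_prod_integral_diff_le[OF cont C, of N]
        by (simp add: cesaro_mean_eq_integral[where \<alpha> = \<alpha>, OF cont] continuous_torus_action_one[OF assms])
      with elim show ?case by simp
    qed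
  qed
qed

end
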